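(* Let $\alpha>-1$ and let $u$ be a sense-preserving complex-valued kernel $\alpha$-harmonic mapping on the unit disk $\mathbb{D}$ with $u(0)=0$ and $|u(z)|<1$ for all $z\in\mathbb{D}$. If $J_{u}(0)=1$ or $\lambda_{u}(0)=1$, then $u(z)=\beta z$ for all $z\in\mathbb{D}$, for some constant $\beta\in\mathbb{C}$ with $|\beta|=1$.
   Context: $\mathbb{D}$ is the open unit disk in $\mathbb{C}$. For $\alpha>-1$, a complex-valued kernel $\alpha$-harmonic mapping is a function $u\in\mathcal{C}^{2}(\mathbb{D})$, $u:\mathbb{D}\to\mathbb{C}$, satisfying $\frac{\partial}{\partial z}\left((1-|z|^{2})^{-\alpha}\frac{\partial u}{\partial\bar z}\right)=0$ in $\mathbb{D}$. It is known that these are exactly the functions given by a convergent expansion $u(z)=\sum_{k=0}^{\infty}c_{k}z^{k}+\sum_{k=1}^{\infty}c_{-k}P_{\alpha,k}(|z|^{2})\bar{z}^{k}$ with complex coefficients $\{c_k\}_{k\in\mathbb{Z}}$ satisfying $\limsup_{|k|\to\infty}|c_{k}|^{1/|k|}\le 1$, where $P_{\alpha,k}(x)=\int_{0}^{1}t^{k-1}(1-tx)^{\alpha}\,dt$ for $-1<x<1$. Such a mapping $u$, not identically constant, is called sense-preserving at $z_{0}\in\mathbb{D}$ if $u_{z}\not\equiv 0$, the function $\omega:=(\overline{u})_{z}/u_{z}$ is well defined at $z_{0}$ (possibly with a removable singularity), and $|\omega(z_{0})|<1$; it is sense-preserving in $\mathbb{D}$ if it is sense-preserving at every point of $\mathbb{D}$.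 Notation: $J_{u}=|u_{z}|^{2}-|u_{\bar z}|^{2}$ is the Jacobian and $\lambda_{u}=\big||u_{z}|-|u_{\bar z}|\big|$. *)

theory Defs
  imports "HOL-Analysis.Analysis"
begin

abbreviation unit_disk :: "complex set" where
  "unit_disk \<equiv> ball 0 1"

text \<open>
  \<open>Ck_on k f S\<close>: \<open>f\<close> is of class \<open>C\<^sup>k\<close> in the real sense on \<open>S\<close>. Only meant for open \<open>S\<close>, because
  \<^const>\<open>frechet_derivative\<close> is taken at full neighbourhoods. For a fixed direction \<open>v\<close>,
  \<open>\<lambda>x. frechet_derivative f (at x) v\<close> is the directional derivative of \<open>f\<close> along \<open>v\<close>.
\<close>

primrec Ck_on ::
  "nat \<Rightarrow> ('a::euclidean_space \<Rightarrow> 'b::real_normed_vector) \<Rightarrow> 'a set \<Rightarrow> bool" where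
  "Ck_on 0 f S \<longleftrightarrow> continuous_on S f"
| "Ck_on (Suc k) f S \<longleftrightarrow>
     f differentiable_on S \<and> (\<forall>v. Ck_on k (\<lambda>x. frechet_derivative f (at x) v) S)"

text \<open>
  The Wirtinger derivatives \<open>(f\<^sub>x - i f\<^sub>y) / 2\<close> and \<open>(f\<^sub>x + i f\<^sub>y) / 2\<close>. The Frechet derivative is the
  real one, so its values at \<open>1\<close> and \<open>\<i>\<close> are the partial derivatives \<open>f\<^sub>x\<close> and \<open>f\<^sub>y\<close>.
\<close>

definition d_z :: "(complex \<Rightarrow> complex) \<Rightarrow> complex \<Rightarrow> complex" where
  "d_z f z = (frechet_derivative f (at z) 1 - \<i> * frechet_derivative f (at z) \<i>) / 2"

definition d_zbar :: "(complex \<Rightarrow> complex) \<Rightarrow> complex \<Rightarrow> complex" where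
  "d_zbar f z = (frechet_derivative f (at z) 1 + \<i> * frechet_derivative f (at z) \<i>) / 2"

definition kernel_alpha_harmonic :: "real \<Rightarrow> (complex \<Rightarrow> complex) \<Rightarrow> bool" where
  "kernel_alpha_harmonic \<alpha> u \<longleftrightarrow>
     Ck_on 2 u unit_disk \<and>
     (\<forall>z\<in>unit_disk.
        d_z (\<lambda>w. complex_of_real ((1 - (cmod w)\<^sup>2) powr (- \<alpha>)) * d_zbar u w) z = 0)"

definition dilatation :: "(complex \<Rightarrow> complex) \<Rightarrow> complex \<Rightarrow> complex" where
  "dilatation u z = d_z (\<lambda>w. cnj (u w)) z / d_z u z"

text \<open>
  \<open>dilatation_value u z0 w\<close>: the dilatation of \<open>u\<close> is well defined at \<open>z0\<close>, with value \<open>w\<close>. At a zero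
  of \<open>u\<^sub>z\<close> this means that the singularity is removable: the quotient, on the set where its
  denominator does not vanish, has the limit \<open>w\<close> at \<open>z0\<close>. As \<open>u\<^sub>z\<close> need not be holomorphic, its zeros
  need not be isolated; \<open>z0\<close> is only required to be a limit point of that set, so that the limit
  is meaningful and unique.
\<close>

definition dilatation_value :: "(complex \<Rightarrow> complex) \<Rightarrow> complex \<Rightarrow> complex \<Rightarrow> bool" where
  "dilatation_value u z0 w \<longleftrightarrow>
     (if d_z u z0 \<noteq> 0 then w = dilatation u z0
      else z0 islimpt {z \<in> unit_disk. d_z u z \<noteq> 0} \<and>
        (dilatation u \<longlongrightarrow> w) (at z0 within {z \<in> unit_disk. d_z u z \<noteq> 0}))"

definition sense_preserving_at :: "(complex \<Rightarrow> complex) \<Rightarrow> complex \<Rightarrow> bool" where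
  "sense_preserving_at u z0 \<longleftrightarrow>
     \<not> u constant_on unit_disk \<and>
     (\<exists>z\<in>unit_disk. d_z u z \<noteq> 0) \<and>
     (\<exists>w. dilatation_value u z0 w \<and> cmod w < 1)"

definition sense_preserving :: "(complex \<Rightarrow> complex) \<Rightarrow> bool" where
  "sense_preserving u \<longleftrightarrow> (\<forall>z0\<in>unit_disk. sense_preserving_at u z0)"

definition jacobian_J :: "(complex \<Rightarrow> complex) \<Rightarrow> complex \<Rightarrow> real" where
  "jacobian_J u z = (cmod (d_z u z))\<^sup>2 - (cmod (d_zbar u z))\<^sup>2"

definition lambda_min :: "(complex \<Rightarrow> complex) \<Rightarrow> complex \<Rightarrow> real" where
  "lambda_min u z = \<bar>cmod (d_z u z) - cmod (d_zbar u z)\<bar>"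

end

theory Submission
  imports Defs "HOL-Complex_Analysis.Complex_Analysis"
begin

text \<open>
  The equation says that \<open>g\<close>, the conjugate of \<open>(1 - |z|\<^sup>2) powr (- \<alpha>) * u\<^sub>z\<^sub>b\<^sub>a\<^sub>r\<close>, is holomorphic. Let \<open>c\<^sub>n r\<close>
  be the integral of \<open>u (r e\<^sup>i\<^sup>t) e\<^sup>-\<^sup>i\<^sup>n\<^sup>t\<close> over a period. Since \<open>c\<^sub>n' = (n / r) c\<^sub>n + 2 c\<^sub>n\<^sub>+\<^sub>1(u\<^sub>z\<^sub>b\<^sub>a\<^sub>r)\<close>,
  first \<open>c\<^sub>1 r = 2 \<pi> u\<^sub>z(0) r\<close>, and secondly \<open>r\<^sup>k c\<^sub>-\<^sub>k\<close> has derivative a positive function times the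
  conjugate of the \<open>(k - 1)\<close>-st Taylor coefficient of \<open>g\<close>. The normalization forces \<open>|u\<^sub>z(0)| \<ge> 1\<close>, so
  Bessel's inequality leaves no room for \<open>c\<^sub>-\<^sub>k\<close> as \<open>r\<close> tends to 1. As \<open>r\<^sup>k c\<^sub>-\<^sub>k\<close> also vanishes at 0,
  its derivative cannot have a constant direction unless the Taylor coefficient is 0. Hence \<open>g = 0\<close>,
  \<open>u\<close> is holomorphic, and the Schwarz lemma applies.
\<close>

section \<open>Calculus of the Wirtinger derivatives\<close>

lemma has_derivative_Wirtinger:
  assumes "f differentiable (at z)"
  shows "(f has_derivative (\<lambda>v. d_z f z * v + d_zbar f z * cnj v)) (at z)"
proof -
  define D where "D = frechet_derivative f (at z)"
  have D: "(f has_derivative D) (at z)"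
    using assms unfolding D_def frechet_derivative_works .
  interpret D: bounded_linear D
    using D by (rule has_derivative_bounded_linear)
  have "D v = d_z f z * v + d_zbar f z * cnj v" for v
  proof -
    have "D v = D (Re v *\<^sub>R 1 + Im v *\<^sub>R \<i>)"
      by (rule arg_cong[where f = D]) (simp add: complex_eq_iff)
    also have "\<dots> = Re v * D 1 + Im v * D \<i>"
      unfolding D.add D.scaleR by (simp only: scaleR_conv_of_real)
    also have "\<dots> = d_z f z * v + d_zbar f z * cnj v"
      unfolding d_z_def d_zbar_def D_def[symmetric]
      by (simp add: complex_eq_iff field_simps)
    finally show ?thesis .
  qed
  then have "D = (\<lambda>v. d_z f z * v + d_zbar f z * cnj v)"
    by (rule ext)
  with D show ?thesis
    by (simp only:)
qed

lemma Wirtinger_eqI: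
  assumes "(f has_derivative (\<lambda>v. a * v + b * cnj v)) (at z)"
  shows "d_z f z = a" "d_zbar f z = b"
proof -
  have "frechet_derivative f (at z) = (\<lambda>v. a * v + b * cnj v)"
    using assms by (metis frechet_derivative_at)
  then show "d_z f z = a" "d_zbar f z = b"
    by (simp_all add: d_z_def d_zbar_def field_simps)
qed

lemma d_z_cnj:
  assumes "f differentiable (at z)"
  shows "d_z (\<lambda>w. cnj (f w)) z = cnj (d_zbar f z)"
proof (rule Wirtinger_eqI(1))
  show "((\<lambda>w. cnj (f w)) has_derivative (\<lambda>v. cnj (d_zbar f z) * v + cnj (d_z f z) * cnj v)) (at z)"
    using has_derivative_cnj[OF has_derivative_Wirtinger[OF assms]] by (simp add: add.commute)
qed

text \<open>Without its conjugate-linear part the real derivative is multiplication by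
  \<open>d_z f z\<close>, hence complex linear.\<close>

lemma holomorphic_on_Wirtinger:
  assumes "open S" "\<And>z. z \<in> S \<Longrightarrow> f differentiable (at z)" "\<And>z. z \<in> S \<Longrightarrow> d_zbar f z = 0"
  shows "f holomorphic_on S"
proof -
  have "(f has_field_derivative d_z f z) (at z)" if "z \<in> S" for z
    using has_derivative_Wirtinger[OF assms(2)[OF that]] assms(3)[OF that]
    by (simp add: has_field_derivative_def)
  then show ?thesis
    using assms(1) holomorphic_on_open by blast
qed

section \<open>Polar coordinates and Fourier coefficients on circles\<close>

lemma has_vector_derivative_radial:
  assumes "f differentiable (at (of_real r * cis t))"
  shows "((\<lambda>x. f (of_real x * cis t)) has_vector_derivative
      d_z f (of_real r * cis t) * cis t + d_zbar f (of_real r * cis t) * cis (- t)) (at r within A)"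
proof -
  have "((\<lambda>x. of_real x * cis t) has_derivative (\<lambda>h. of_real h * cis t)) (at r within A)"
    by (auto intro!: derivative_eq_intros)
  from has_derivative_compose[OF this has_derivative_Wirtinger[OF assms]] show ?thesis
    unfolding has_vector_derivative_def
    by (rule has_derivative_eq_rhs) (simp add: fun_eq_iff cis_cnj scaleR_conv_of_real algebra_simps)
qed

lemma has_vector_derivative_angular:
  assumes "f differentiable (at (of_real r * cis t))"
  shows "((\<lambda>x. f (of_real r * cis x)) has_vector_derivative
      \<i> * r * (d_z f (of_real r * cis t) * cis t - d_zbar f (of_real r * cis t) * cis (- t))) (at t within A)"
proof -
  have "((\<lambda>x. of_real r * cis x) has_derivative (\<lambda>h. \<i> * of_real h * r * cis t)) (at t within A)"
    by (auto intro!: derivative_eq_intros simp: scaleR_conv_of_real algebra_simps)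
  from has_derivative_compose[OF this has_derivative_Wirtinger[OF assms]] show ?thesis
    unfolding has_vector_derivative_def
    by (rule has_derivative_eq_rhs) (simp add: fun_eq_iff cis_cnj scaleR_conv_of_real algebra_simps)
qed

text \<open>This is \<open>2 * pi\<close> times the usual Fourier coefficient of \<open>f\<close> on
  the circle of radius \<open>r\<close>; leaving out the normalization puts factors
  \<open>2 * pi\<close> into the bounds below.\<close>

definition circle_coeff :: "(complex \<Rightarrow> complex) \<Rightarrow> int \<Rightarrow> real \<Rightarrow> complex" where
  "circle_coeff f n r = integral {0..2*pi} (\<lambda>t. f (of_real r * cis t) * cis (- (of_int n * t)))"

lemma continuous_on_circle:
  assumes "continuous_on unit_disk f" "0 < r" "r < 1"
  shows "continuous_on A (\<lambda>t. f (of_real r * cis t))"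
  by (rule continuous_on_compose2[OF assms(1)])
     (use assms in \<open>auto simp: norm_mult intro!: continuous_intros\<close>)

lemma circle_coeff_integrable:
  assumes "continuous_on unit_disk f" "0 < r" "r < 1"
  shows "(\<lambda>t. f (of_real r * cis t) * cis (- (of_int n * t))) integrable_on {0..2*pi}"
  by (rule integrable_continuous_real[OF continuous_on_mult[OF continuous_on_circle[OF assms]]])
     (intro continuous_intros)

lemma norm_circle_coeff_le:
  assumes "continuous_on unit_disk f" "0 < r" "r < 1"
    and "\<And>z. cmod z = r \<Longrightarrow> cmod (f z) \<le> B"
  shows "cmod (circle_coeff f n r) \<le> 2 * pi * B"
proof -
  have "cmod (circle_coeff f n r) \<le> B * (2 * pi - 0)"
    unfolding circle_coeff_def
  proof (rule integral_bound)
    show "continuous_on {0..2*pi} (\<lambda>t. f (of_real r * cis t) * cis (- (of_int n * t)))"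
      by (rule continuous_on_mult[OF continuous_on_circle[OF assms(1-3)]]) (intro continuous_intros)
  qed (use assms in \<open>auto simp: norm_mult\<close>)
  then show ?thesis by (simp add: mult.commute)
qed

lemma has_integral_cis_period:
  assumes "n \<noteq> 0"
  shows "((\<lambda>t. cis (of_int n * t)) has_integral 0) {0..2*pi}"
proof -
  have "((\<lambda>t. cis (of_int n * t) / (\<i> * of_int n)) has_vector_derivative cis (of_int n * t)) (at t within A)" for t A
    using assms unfolding has_vector_derivative_def
    by (auto intro!: derivative_eq_intros simp: scaleR_conv_of_real field_simps)
  then have "((\<lambda>t. cis (of_int n * t)) has_integral
      cis (of_int n * (2 * pi)) / (\<i> * of_int n) - cis (of_int n * 0) / (\<i> * of_int n)) {0..2*pi}"
    by (intro fundamental_theorem_of_calculus) auto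
  then show ?thesis
    using cis_multiple_2pi[of "of_int n"] by (simp add: mult.commute)
qed

lemma has_integral_const_period: "((\<lambda>t. c) has_integral (2 * pi) *\<^sub>R c) {0..2*pi}"
  using has_integral_const_real[of c 0 "2 * pi"] by simp

text \<open>This yields a linear ODE in \<open>r\<close> whose inhomogeneity involves only
  \<open>d_zbar f\<close>, the quantity that is explicit for a kernel mapping. The factor
  \<open>cis (- t)\<close> that accompanies \<open>d_zbar f\<close> in polar coordinates shifts the
  index to \<open>n + 1\<close>.\<close>

lemma circle_coeff_has_vector_derivative:
  assumes diff: "\<And>z. z \<in> unit_disk \<Longrightarrow> f differentiable (at z)"
    and cz: "continuous_on unit_disk (d_z f)" and czb: "continuous_on unit_disk (d_zbar f)"
    and r: "0 < r" "r < 1"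
  shows "(circle_coeff f n has_vector_derivative
      (of_int n / r * circle_coeff f n r + 2 * circle_coeff (d_zbar f) (n + 1) r)) (at r)"
proof -
  have cf: "continuous_on unit_disk f"
    using diff by (meson continuous_at_imp_continuous_on differentiable_imp_continuous_within)
  define fr where "fr = (\<lambda>x t. (d_z f (of_real x * cis t) * cis t
      + d_zbar f (of_real x * cis t) * cis (- t)) * cis (- (of_int n * t)))"
  have in_disk: "of_real x * cis t \<in> unit_disk" if "x \<in> {0<..<1}" for x t
    using that by (simp add: norm_mult)
  have D: "((\<lambda>x. f (of_real x * cis t) * cis (- (of_int n * t))) has_vector_derivative fr x t)
      (at x within {0<..<1})" if "x \<in> {0<..<1}" for x t
    unfolding fr_def
    by (intro has_vector_derivative_mult_left
        has_vector_derivative_radial[OF diff[OF in_disk[OF that]]])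
  have polar: "continuous_on ({0<..<1} \<times> cbox 0 (2*pi)) (\<lambda>p. of_real (fst p) * cis (snd p))"
    "(\<lambda>p. of_real (fst p) * cis (snd p)) ` ({0<..<1} \<times> cbox 0 (2*pi)) \<subseteq> unit_disk"
    by (intro continuous_intros) (auto simp: norm_mult)
  have C: "continuous_on ({0<..<1} \<times> cbox 0 (2*pi)) (\<lambda>(x, t). fr x t)"
    unfolding fr_def split_beta
    by (intro continuous_intros continuous_on_compose2[OF cz polar] continuous_on_compose2[OF czb polar])
  have "((\<lambda>x. integral (cbox 0 (2*pi)) (\<lambda>t. f (of_real x * cis t) * cis (- (of_int n * t))))
      has_vector_derivative integral (cbox 0 (2*pi)) (fr r)) (at r within {0<..<1})"
    by (rule leibniz_rule_vector_derivative[OF D _ C])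
       (use r in \<open>auto intro!: circle_coeff_integrable[OF cf]\<close>)
  then have main: "(circle_coeff f n has_vector_derivative integral {0..2*pi} (fr r)) (at r)"
    unfolding circle_coeff_def using r by (simp add: at_within_open_NO_MATCH fun_eq_iff)
  \<comment> \<open>\<open>f\<^sub>r = 2 f\<^sub>z\<^sub>b\<^sub>a\<^sub>r e\<^sup>-\<^sup>i\<^sup>t + f\<^sub>t / (i r)\<close>, and the \<open>t\<close>-derivative is integrated by parts.\<close>
  define P where "P = (\<lambda>t. f (of_real r * cis t) * cis (- (of_int n * t)))"
  define P' where "P' = (\<lambda>t. \<i> * r * (d_z f (of_real r * cis t) * cis t
      - d_zbar f (of_real r * cis t) * cis (- t)) * cis (- (of_int n * t)) - \<i> * of_int n * P t)"
  have "(P has_vector_derivative P' t) (at t within {0..2*pi})" for t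
  proof -
    have "((\<lambda>t. cis (- (of_int n * t))) has_vector_derivative - \<i> * of_int n * cis (- (of_int n * t)))
        (at t within {0..2*pi})"
      unfolding has_vector_derivative_def
      by (auto intro!: derivative_eq_intros simp: scaleR_conv_of_real)
    moreover have "f differentiable (at (of_real r * cis t))"
      using r by (intro diff in_disk) simp
    ultimately have "(P has_vector_derivative
        f (of_real r * cis t) * (- \<i> * of_int n * cis (- (of_int n * t))) +
        \<i> * r * (d_z f (of_real r * cis t) * cis t - d_zbar f (of_real r * cis t) * cis (- t)) *
          cis (- (of_int n * t))) (at t within {0..2*pi})"
      unfolding P_def by (intro has_vector_derivative_mult has_vector_derivative_angular)
    then show ?thesis unfolding P_def P'_def by (simp add: algebra_simps)
  qed
  then have "(P' has_integral (P (2*pi) - P 0)) {0..2*pi}"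
    by (intro fundamental_theorem_of_calculus) auto
  \<comment> \<open>As \<open>n\<close> is an integer, \<open>P\<close> has period
    \<open>2 * pi\<close>, so the integration by parts leaves no boundary term.\<close>
  moreover have "cis (- (of_int n * (2*pi))) = 1"
    using cis_multiple_2pi[of "- of_int n"] by (simp add: mult_ac)
  then have "P (2*pi) = P 0"
    unfolding P_def by (simp only: cis_2pi) simp
  ultimately have I1: "(P' has_integral 0) {0..2*pi}" by simp
  have I2: "(P has_integral circle_coeff f n r) {0..2*pi}"
    unfolding P_def circle_coeff_def by (rule integrable_integral[OF circle_coeff_integrable[OF cf r]])
  have I3: "((\<lambda>t. d_zbar f (of_real r * cis t) * cis (- (of_int (n + 1) * t))) has_integral
      circle_coeff (d_zbar f) (n + 1) r) {0..2*pi}"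
    unfolding circle_coeff_def by (rule integrable_integral[OF circle_coeff_integrable[OF czb r]])
  have "((\<lambda>t. 1 / (\<i> * r) * (P' t + \<i> * of_int n * P t) +
        2 * (d_zbar f (of_real r * cis t) * cis (- (of_int (n + 1) * t)))) has_integral
      1 / (\<i> * r) * (0 + \<i> * of_int n * circle_coeff f n r) + 2 * circle_coeff (d_zbar f) (n + 1) r) {0..2*pi}"
    by (intro has_integral_add has_integral_mult_right I1 I2 I3)
  also have "(\<lambda>t. 1 / (\<i> * r) * (P' t + \<i> * of_int n * P t) +
        2 * (d_zbar f (of_real r * cis t) * cis (- (of_int (n + 1) * t)))) = fr r"
  proof
    fix t
    have "cis (- (of_int (n + 1) * t)) = cis (- t) * cis (- (of_int n * t))"
      by (simp add: cis_mult algebra_simps)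
    then show "1 / (\<i> * r) * (P' t + \<i> * of_int n * P t) +
        2 * (d_zbar f (of_real r * cis t) * cis (- (of_int (n + 1) * t))) = fr r t"
      using r by (simp add: P'_def fr_def field_simps)
  qed
  finally have "integral {0..2*pi} (fr r) =
      1 / (\<i> * r) * (0 + \<i> * of_int n * circle_coeff f n r) + 2 * circle_coeff (d_zbar f) (n + 1) r"
    by (rule integral_unique)
  also have "\<dots> = of_int n / r * circle_coeff f n r + 2 * circle_coeff (d_zbar f) (n + 1) r"
    using r by (simp add: field_simps)
  finally show ?thesis using main by simp
qed

lemma circle_coeff_cnj: "circle_coeff (\<lambda>z. cnj (f z)) n r = cnj (circle_coeff f (- n) r)"
  unfolding circle_coeff_def integral_cnj by (simp add: cis_cnj)

text \<open>Cauchy's formula for the Taylor coefficients, with the circle parametrized by the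
  angle.\<close>

lemma circle_coeff_holomorphic:
  fixes f :: "complex \<Rightarrow> complex"
  assumes "f holomorphic_on unit_disk" "0 < r" "r < 1"
  shows "circle_coeff f (int j) r = 2 * pi * r ^ j * ((deriv ^^ j) f 0 / fact j)"
proof -
  have "((\<lambda>w. f w / (w - 0) ^ Suc j) has_contour_integral 2 * pi * \<i> / fact j * (deriv ^^ j) f 0) (circlepath 0 r)"
    using assms by (intro Cauchy_has_contour_integral_higher_derivative_circlepath
        holomorphic_on_imp_continuous_on) (auto elim!: holomorphic_on_subset)
  then have "((\<lambda>t. f (of_real r * cis t) / (of_real r * cis t) ^ Suc j * r * \<i> * cis t) has_integral
      2 * pi * \<i> / fact j * (deriv ^^ j) f 0) {0..2*pi}"
    unfolding circlepath_def by (subst (asm) has_contour_integral_part_circlepath_iff) auto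
  \<comment> \<open>On the circle, dz / z^(j+1) equals i r^(-j) e^(-ijt) dt; the factor removes i
    r^(-j).\<close>
  from has_integral_mult_right[OF this, of "r ^ j / \<i>"]
  have "((\<lambda>t. f (of_real r * cis t) * cis (- (of_int (int j) * t))) has_integral
      2 * pi * r ^ j * ((deriv ^^ j) f 0 / fact j)) {0..2*pi}"
  proof (rule has_integral_eq_rhs[OF has_integral_eq[rotated]])
    show "r ^ j / \<i> * (f (of_real r * cis t) / (of_real r * cis t) ^ Suc j * r * \<i> * cis t)
        = f (of_real r * cis t) * cis (- (of_int (int j) * t))" for t
    proof -
      have "cis (- (of_int (int j) * t)) = 1 / cis t ^ j"
        by (metis Complex.DeMoivre cis_inverse inverse_eq_divide of_int_of_nat_eq)
      then show ?thesis using assms by (simp add: field_simps power_mult_distrib)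
    qed
  qed (simp add: field_simps)
  then show ?thesis unfolding circle_coeff_def by (rule integral_unique)
qed

text \<open>Multiplication by \<open>z ^ m\<close> moves the index from \<open>- m\<close> to 0,
  where the coefficient is \<open>2 * pi\<close> times the value at the centre; that value is 0
  because \<open>m\<close> is positive.\<close>

lemma circle_coeff_holomorphic_neg:
  assumes "f holomorphic_on unit_disk" "0 < r" "r < 1" "0 < m"
  shows "circle_coeff f (- int m) r = 0"
proof -
  have "circle_coeff (\<lambda>z. f z * z ^ m) (int 0) r = 0"
    using assms by (subst circle_coeff_holomorphic) (auto intro!: holomorphic_intros)
  also have "circle_coeff (\<lambda>z. f z * z ^ m) (int 0) r = r ^ m * circle_coeff f (- int m) r"
    unfolding circle_coeff_def integral_mult_right[symmetric]
    by (rule integral_cong) (simp add: power_mult_distrib Complex.DeMoivre)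
  finally show ?thesis using assms by simp
qed

text \<open>Let \<open>w\<close> be the trigonometric polynomial formed with the two coefficients
  \<open>a\<close> and \<open>b\<close>. Since the modulus of \<open>F\<close> is at most 1, (2
  pi)^2 - 4 pi Re (F cnj w) + |w|^2 is at least (2 pi - |w|)^2. Its integral is 2 pi ((2 pi)^2 - S)
  with S = |a|^2 + |b|^2, which therefore cannot be negative.\<close>

lemma circle_coeff_Bessel:
  assumes f: "continuous_on unit_disk f" and r: "0 < r" "r < 1" and nm: "n \<noteq> m"
    and le: "\<And>z. cmod z = r \<Longrightarrow> cmod (f z) \<le> 1"
  shows "(cmod (circle_coeff f n r))\<^sup>2 + (cmod (circle_coeff f m r))\<^sup>2 \<le> (2 * pi)\<^sup>2"
proof -
  define a b where "a = circle_coeff f n r" and "b = circle_coeff f m r"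
  define en em where "en = (\<lambda>t::real. cis (of_int n * t))" and "em = (\<lambda>t::real. cis (of_int m * t))"
  define w where "w = (\<lambda>t. a * en t + b * em t)"
  define F where "F = (\<lambda>t. f (of_real r * cis t))"
  have ia: "((\<lambda>t. F t * cnj (en t)) has_integral a) {0..2*pi}"
    and ib: "((\<lambda>t. F t * cnj (em t)) has_integral b) {0..2*pi}"
    unfolding a_def b_def circle_coeff_def F_def en_def em_def cis_cnj
    by (rule integrable_integral circle_coeff_integrable[OF f r])+
  have "((\<lambda>t. cnj a * (F t * cnj (en t)) + cnj b * (F t * cnj (em t))) has_integral
      cnj a * a + cnj b * b) {0..2*pi}"
    by (intro has_integral_add has_integral_mult_right ia ib)
  then have "((\<lambda>t. F t * cnj (w t)) has_integral cnj a * a + cnj b * b) {0..2*pi}"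
    by (rule has_integral_eq[rotated]) (simp add: w_def algebra_simps)
  then have iFw: "((\<lambda>t. Re (F t * cnj (w t))) has_integral (cmod a)\<^sup>2 + (cmod b)\<^sup>2) {0..2*pi}"
    by (rule has_integral_eq_rhs[OF has_integral_Re]) (simp add: cmod_power2, simp add: power2_eq_square)
  \<comment> \<open>Orthogonality of the two exponentials, which removes the cross term from the
    integral of |w|^2.\<close>
  have "((\<lambda>t. cis (of_int (n - m) * t)) has_integral 0) {0..2*pi}"
    by (rule has_integral_cis_period) (use nm in simp)
  then have "((\<lambda>t. a * cnj b * cis (of_int (n - m) * t)) has_integral a * cnj b * 0) {0..2*pi}"
    by (rule has_integral_mult_right)
  then have cross: "((\<lambda>t. Re (a * cnj b * cis (of_int (n - m) * t))) has_integral 0) {0..2*pi}"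
    by (rule has_integral_eq_rhs[OF has_integral_Re]) simp
  define S where "S = (cmod a)\<^sup>2 + (cmod b)\<^sup>2"
  have iw: "((\<lambda>t. S + 2 * Re (a * cnj b * cis (of_int (n - m) * t))) has_integral
      (2 * pi) *\<^sub>R S + 2 * 0) {0..2*pi}"
    by (intro has_integral_add has_integral_mult_right cross has_integral_const_period)
  have "((\<lambda>t. (2*pi)\<^sup>2 - 2 * (2*pi) * Re (F t * cnj (w t))
        + (S + 2 * Re (a * cnj b * cis (of_int (n - m) * t)))) has_integral
      (2 * pi) *\<^sub>R (2*pi)\<^sup>2 - 2 * (2*pi) * S + ((2 * pi) *\<^sub>R S + 2 * 0)) {0..2*pi}"
    using iFw unfolding S_def[symmetric]
    by (intro has_integral_add[OF _ iw] has_integral_diff has_integral_mult_right has_integral_const_period)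
  then have "0 \<le> (2 * pi) *\<^sub>R (2*pi)\<^sup>2 - 2 * (2*pi) * S + ((2 * pi) *\<^sub>R S + 2 * 0)"
  proof (rule has_integral_nonneg)
    fix t
    have w2: "S + 2 * Re (a * cnj b * cis (of_int (n - m) * t)) = (cmod (w t))\<^sup>2"
    proof -
      have "cis (of_int (n - m) * t) = en t * cnj (em t)"
        by (simp add: en_def em_def cis_cnj cis_mult algebra_simps)
      moreover have "(cmod (x + y))\<^sup>2 = (cmod x)\<^sup>2 + (cmod y)\<^sup>2 + 2 * Re (x * cnj y)" for x y
        by (simp add: cmod_power2 power2_sum)
      moreover have "cmod (en t) = 1" "cmod (em t) = 1"
        by (simp_all add: en_def em_def)
      ultimately show ?thesis
        unfolding w_def S_def by (simp only: norm_mult complex_cnj_mult mult_ac mult_1_left)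
    qed
    have "cmod (F t) \<le> 1"
      unfolding F_def using r by (intro le) (simp add: norm_mult)
    then have "Re (F t * cnj (w t)) \<le> cmod (w t)"
      by (metis complex_Re_le_cmod complex_mod_cnj dual_order.trans mult_left_le_one_le norm_ge_zero norm_mult)
    then have "2 * (2*pi) * Re (F t * cnj (w t)) \<le> 2 * (2*pi) * cmod (w t)"
      by (intro mult_left_mono) auto
    moreover have "0 \<le> (2*pi - cmod (w t))\<^sup>2" by simp
    ultimately show "0 \<le> (2*pi)\<^sup>2 - 2 * (2*pi) * Re (F t * cnj (w t))
        + (S + 2 * Re (a * cnj b * cis (of_int (n - m) * t)))"
      unfolding w2 power2_diff by linarith
  qed
  then have "(2 * pi) * S \<le> (2 * pi) * (2 * pi)\<^sup>2"
    by (simp add: algebra_simps)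
  then show ?thesis
    unfolding S_def a_def b_def by (simp only: mult_le_cancel_left_pos pi_gt_zero mult_pos_pos zero_less_numeral)
qed

text \<open>Replace \<open>f\<close> near 0 by its linear part c z + d cnj z. The first term
  contributes exactly 2 pi c r, the second integrates to 0, and the remainder is o(r).\<close>

lemma circle_coeff_one_tendsto:
  assumes f: "continuous_on unit_disk f" "f differentiable (at 0)" "f 0 = 0"
  shows "((\<lambda>r. circle_coeff f 1 r / r) \<longlongrightarrow> 2 * pi * d_z f 0) (at_right 0)"
proof (rule tendstoI)
  fix e :: real assume e: "0 < e"
  define c d where "c = d_z f 0" and "d = d_zbar f 0"
  \<comment> \<open>The remainder contributes at most \<open>2 * pi * e'\<close>, which is then half
    of \<open>e\<close>.\<close>
  define e' where "e' = e / (4 * pi)"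
  have "0 < e'" using e by (simp add: e'_def)
  with has_derivative_Wirtinger[OF f(2)] f(3) obtain \<delta> where \<delta>: "0 < \<delta>"
    and le: "\<And>z. cmod z < \<delta> \<Longrightarrow> cmod (f z - (c * z + d * cnj z)) \<le> e' * cmod z"
    unfolding has_derivative_at_alt c_def d_def by force
  have "dist (circle_coeff f 1 r / r) (2 * pi * d_z f 0) < e" if r: "r \<in> {0<..<min \<delta> 1}" for r
  proof -
    define h where "h = (\<lambda>z. f z - (c * z + d * cnj z))"
    have ch: "continuous_on unit_disk h"
      unfolding h_def by (intro continuous_intros f)
    \<comment> \<open>The frequency -2 comes from the conjugate term, of frequency -1, times the
      factor \<open>cis (- t)\<close> of the coefficient.\<close>
    have "((\<lambda>t. cis (of_int (-2) * t)) has_integral 0) {0..2*pi}"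
      by (rule has_integral_cis_period) simp
    then have "((\<lambda>t. c * r + d * r * cis (of_int (-2) * t)) has_integral
        (2 * pi) *\<^sub>R (c * r) + d * r * 0) {0..2*pi}"
      by (intro has_integral_add has_integral_mult_right has_integral_const_period)
    moreover have "((\<lambda>t. h (of_real r * cis t) * cis (- (of_int 1 * t))) has_integral circle_coeff h 1 r) {0..2*pi}"
      unfolding circle_coeff_def
      by (rule integrable_integral[OF circle_coeff_integrable[OF ch]]) (use r in auto)
    ultimately have "((\<lambda>t. h (of_real r * cis t) * cis (- (of_int 1 * t)) + (c * r + d * r * cis (of_int (-2) * t)))
        has_integral circle_coeff h 1 r + ((2 * pi) *\<^sub>R (c * r) + d * r * 0)) {0..2*pi}"
      by (rule has_integral_add[rotated])
    then have "((\<lambda>t. f (of_real r * cis t) * cis (- (of_int 1 * t))) has_integral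
         circle_coeff h 1 r + ((2 * pi) *\<^sub>R (c * r) + d * r * 0)) {0..2*pi}"
      by (rule has_integral_eq[rotated])
         (simp add: h_def algebra_simps cis_cnj cis_mult)
    then have "circle_coeff f 1 r = circle_coeff h 1 r + 2 * pi * c * r"
      unfolding circle_coeff_def[of f] by (simp add: integral_unique scaleR_conv_of_real mult_ac)
    then have "circle_coeff f 1 r / r - 2 * pi * d_z f 0 = circle_coeff h 1 r / r"
      using r by (simp add: c_def field_simps)
    moreover have "cmod (circle_coeff h 1 r) \<le> 2 * pi * (e' * r)"
      by (rule norm_circle_coeff_le[OF ch]) (use r le in \<open>auto simp: h_def\<close>)
    then have "cmod (circle_coeff h 1 r / r) \<le> 2 * pi * e'"
      using r by (simp add: norm_divide field_simps)
    moreover have "2 * pi * e' < e" using e by (simp add: e'_def)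
    ultimately show ?thesis by (simp add: dist_norm)
  qed
  then show "\<forall>\<^sub>F r in at_right 0. dist (circle_coeff f 1 r / r) (2 * pi * d_z f 0) < e"
    using \<delta> eventually_at_right_real[of 0 "min \<delta> 1"] by (auto elim!: eventually_mono)
qed

lemma circle_coeff_radial_factor:
  assumes "\<And>z. cmod z = r \<Longrightarrow> f z = c * g z" "0 < r"
  shows "circle_coeff f n r = c * circle_coeff g n r"
proof -
  have "f (of_real r * cis t) = c * g (of_real r * cis t)" for t
    using assms by (intro assms(1)) (simp add: norm_mult)
  then show ?thesis
    unfolding circle_coeff_def by (simp add: mult.assoc)
qed

section \<open>Kernel \<alpha>-harmonic mappings\<close>

context
  fixes \<alpha> :: real and u :: "complex \<Rightarrow> complex"
  assumes kernel: "kernel_alpha_harmonic \<alpha> u"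
begin

lemma kernel_differentiable:
  assumes "z \<in> unit_disk"
  shows "u differentiable (at z)" "d_z u differentiable (at z)" "d_zbar u differentiable (at z)"
proof -
  have "Ck_on (Suc (Suc 0)) u unit_disk"
    using kernel unfolding kernel_alpha_harmonic_def by (simp add: numeral_2_eq_2)
  then have "u differentiable_on unit_disk"
    and "\<And>v. (\<lambda>x. frechet_derivative u (at x) v) differentiable_on unit_disk"
    by auto
  then have D: "u differentiable (at z)" "\<And>v. (\<lambda>x. frechet_derivative u (at x) v) differentiable (at z)"
    using assms by (auto simp: differentiable_on_eq_differentiable_at)
  then show "u differentiable (at z)" by blast
  show "d_z u differentiable (at z)" "d_zbar u differentiable (at z)"
    unfolding d_z_def[abs_def] d_zbar_def[abs_def] divide_inverse
    by (intro derivative_intros D)+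
qed

lemma kernel_continuous_on:
  "continuous_on unit_disk u" "continuous_on unit_disk (d_z u)" "continuous_on unit_disk (d_zbar u)"
  using kernel_differentiable
  by (meson continuous_at_imp_continuous_on differentiable_imp_continuous_within)+

lemma kernel_antiholomorphic_part:
  obtains g where "g holomorphic_on unit_disk"
    and "\<And>z. z \<in> unit_disk \<Longrightarrow> d_zbar u z = of_real ((1 - (cmod z)\<^sup>2) powr \<alpha>) * cnj (g z)"
proof
  define G where "G = (\<lambda>z. complex_of_real ((1 - (cmod z)\<^sup>2) powr (- \<alpha>)) * d_zbar u z)"
  have dG: "G differentiable (at z)" if z: "z \<in> unit_disk" for z
  proof -
    \<comment> \<open>Since \<open>cmod\<close> is not differentiable at 0, its square is treated as
      an inner product.\<close>
    have "1 - z \<bullet> z > 0"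
      using z by (simp add: power2_norm_eq_inner[symmetric] abs_square_less_1)
    then have "((\<lambda>z. (1 - z \<bullet> z) powr (- \<alpha>)) has_derivative
        (\<lambda>h. (1 - z \<bullet> z) powr (- \<alpha>) * (0 * ln (1 - z \<bullet> z) + (0 - (z \<bullet> h + h \<bullet> z)) * (- \<alpha>) / (1 - z \<bullet> z)))) (at z)"
      by (intro has_derivative_powr derivative_intros) auto
    then have "(\<lambda>z. of_real ((1 - z \<bullet> z) powr (- \<alpha>)) :: complex) differentiable (at z)"
      using has_derivative_of_real differentiableI by blast
    then show ?thesis
      unfolding G_def power2_norm_eq_inner by (intro differentiable_mult kernel_differentiable z)
  qed
  show "(\<lambda>z. cnj (G z)) holomorphic_on unit_disk"
  proof (rule holomorphic_on_Wirtinger)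
    fix z assume z: "z \<in> unit_disk"
    have "d_z G z = 0"
      using kernel z unfolding kernel_alpha_harmonic_def G_def by blast
    \<comment> \<open>Conjugation exchanges the two Wirtinger derivatives, so the kernel equation
      for \<open>G\<close> is the Cauchy-Riemann equation for its conjugate.\<close>
    then have "((\<lambda>w. cnj (G w)) has_derivative (\<lambda>v. cnj (d_zbar G z) * v + 0 * cnj v)) (at z)"
      using has_derivative_cnj[OF has_derivative_Wirtinger[OF dG[OF z]]] by simp
    then show "(\<lambda>z. cnj (G z)) differentiable (at z)" "d_zbar (\<lambda>z. cnj (G z)) z = 0"
      by (blast intro: differentiableI Wirtinger_eqI)+
  qed simp
  fix z :: complex assume z: "z \<in> unit_disk"
  then have "1 - (cmod z)\<^sup>2 > 0" by (simp add: abs_square_less_1)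
  then have "(1 - (cmod z)\<^sup>2) powr \<alpha> * (1 - (cmod z)\<^sup>2) powr (- \<alpha>) = 1"
    by (simp add: powr_add[symmetric])
  then show "d_zbar u z = of_real ((1 - (cmod z)\<^sup>2) powr \<alpha>) * cnj (cnj (G z))"
    unfolding G_def by (simp only: complex_cnj_cnj mult.assoc[symmetric] of_real_mult[symmetric]) simp
qed

lemma kernel_bounded_holomorphic:
  assumes u0: "u 0 = 0" and bound: "\<And>z. z \<in> unit_disk \<Longrightarrow> cmod (u z) \<le> 1"
    and ge: "1 \<le> cmod (d_z u 0)"
  shows "u holomorphic_on unit_disk"
proof -
  obtain g where g: "g holomorphic_on unit_disk"
    and gz: "\<And>z. z \<in> unit_disk \<Longrightarrow> d_zbar u z = of_real ((1 - (cmod z)\<^sup>2) powr \<alpha>) * cnj (g z)"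
    by (rule kernel_antiholomorphic_part) (rule that)
  \<comment> \<open>The weight is constant on each circle and leaves the integral; conjugating
    \<open>g\<close> reverses the sign of the index.\<close>
  have zbar: "circle_coeff (d_zbar u) m r = of_real ((1 - r\<^sup>2) powr \<alpha>) * cnj (circle_coeff g (- m) r)"
    if "0 < r" "r < 1" for m r
    unfolding circle_coeff_cnj[symmetric]
    by (rule circle_coeff_radial_factor) (use gz that in auto)
  note deriv = circle_coeff_has_vector_derivative[OF kernel_differentiable(1) kernel_continuous_on(2,3)]

  define q where "q = (\<lambda>r. (1 / r) *\<^sub>R circle_coeff u 1 r)"
  have "(q has_vector_derivative 0) (at r within {0<..<1})" if r: "r \<in> {0<..<1}" for r
  proof -
    \<comment> \<open>Index 2 of \<open>d_zbar u\<close> corresponds to index -2 of the holomorphic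
      \<open>g\<close>. The ODE for index 1 is thus c' = c / r, so the quotient \<open>q\<close> is
      constant; its limit at 0 then gives the constant.\<close>
    have "circle_coeff (d_zbar u) (1 + 1) r = 0"
      using r zbar[of r 2] circle_coeff_holomorphic_neg[OF g, of r 2] by simp
    with deriv[of r 1] r
    have "(circle_coeff u 1 has_vector_derivative (circle_coeff u 1 r / r)) (at r)" by simp
    moreover have "((\<lambda>r. 1 / r) has_field_derivative - (1 / r\<^sup>2)) (at r)"
      using r by (auto intro!: derivative_eq_intros simp: power2_eq_square)
    ultimately have "(q has_vector_derivative
        (1 / r) *\<^sub>R (circle_coeff u 1 r / r) + (- (1 / r\<^sup>2)) *\<^sub>R circle_coeff u 1 r) (at r)"
      unfolding q_def by (intro has_vector_derivative_scaleR)
    then show ?thesis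
      using r by (simp add: scaleR_conv_of_real power2_eq_square has_vector_derivative_at_within)
  qed
  then obtain c where c: "\<And>r. r \<in> {0<..<1} \<Longrightarrow> q r = c"
    using has_vector_derivative_zero_constant[of "{0<..<1}" q] by auto
  have "(q \<longlongrightarrow> 2 * pi * d_z u 0) (at_right 0)"
    using circle_coeff_one_tendsto[OF kernel_continuous_on(1) kernel_differentiable(1) u0]
    by (simp add: q_def scaleR_conv_of_real)
  moreover have "(q \<longlongrightarrow> c) (at_right 0)"
    by (rule tendsto_eventually) (use eventually_at_right_real[of 0 1] c in \<open>auto elim!: eventually_mono\<close>)
  ultimately have "c = 2 * pi * d_z u 0"
    using tendsto_unique trivial_limit_at_right_real by blast
  with c have c1: "circle_coeff u 1 r = 2 * pi * d_z u 0 * r" if "0 < r" "r < 1" for r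
    using that by (auto simp: q_def scaleR_conv_of_real field_simps)

  have "(deriv ^^ j) g 0 = 0" for j
  proof (rule ccontr)
    assume nz: "(deriv ^^ j) g 0 \<noteq> 0"
    define \<gamma> where "\<gamma> = (deriv ^^ j) g 0 / fact j"
    have \<gamma>: "\<gamma> \<noteq> 0" using nz by (simp add: \<gamma>_def)
    \<comment> \<open>The ODE raises the index by one, to \<open>- j\<close>, and conjugation turns
      it into \<open>j\<close>: this is the coefficient of \<open>u\<close> driven by the
      \<open>j\<close>-th Taylor coefficient of \<open>g\<close>.\<close>
    define C where "C = circle_coeff u (- int (Suc j))"
    \<comment> \<open>The power of \<open>r\<close> is the integrating factor of the ODE for
      \<open>C\<close>. The derivative of the product is a positive multiple of
      \<open>cnj \<gamma>\<close>, and the factor \<open>\<gamma>\<close> makes it real and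
      positive.\<close>
    define \<phi> where "\<phi> = (\<lambda>r. Re (r ^ Suc j *\<^sub>R C r * \<gamma>))"
    have Dpos: "\<exists>y. DERIV \<phi> r :> y \<and> 0 < y" if r: "0 < r" "r < 1" for r
    proof -
      \<comment> \<open>The constant 4 pi combines the 2 of the ODE with the 2 pi of
        \<open>circle_coeff_holomorphic\<close>.\<close>
      define X where "X = 4 * pi * ((1 - r\<^sup>2) powr \<alpha>) * r ^ j"
      have "circle_coeff (d_zbar u) (- int (Suc j) + 1) r = of_real ((1 - r\<^sup>2) powr \<alpha>) * cnj (2 * pi * r ^ j * \<gamma>)"
        using zbar[OF r, of "- int j"] circle_coeff_holomorphic[OF g r, of j] by (simp add: \<gamma>_def)
      with deriv[OF _ r, of "- int (Suc j)"]
      have "(C has_vector_derivative - of_nat (Suc j) / r * C r + X * cnj \<gamma>) (at r)"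
        unfolding C_def X_def by (simp add: mult_ac)
      moreover have "((\<lambda>r. r ^ Suc j) has_field_derivative of_nat (Suc j) * r ^ j) (at r)"
        by (rule derivative_eq_intros refl | simp)+
      ultimately have "((\<lambda>r. r ^ Suc j *\<^sub>R C r) has_vector_derivative
          r ^ Suc j *\<^sub>R (- of_nat (Suc j) / r * C r + X * cnj \<gamma>) + (of_nat (Suc j) * r ^ j) *\<^sub>R C r) (at r)"
        by (intro has_vector_derivative_scaleR)
      also have "r ^ Suc j *\<^sub>R (- of_nat (Suc j) / r * C r + X * cnj \<gamma>) + (of_nat (Suc j) * r ^ j) *\<^sub>R C r
          = of_real (r ^ Suc j * X) * cnj \<gamma>"
        using r by (simp add: scaleR_conv_of_real field_simps)
      finally have "((\<lambda>r. r ^ Suc j *\<^sub>R C r * \<gamma>) has_vector_derivative of_real (r ^ Suc j * X) * cnj \<gamma> * \<gamma>) (at r)"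
        by (rule has_vector_derivative_mult_left)
      then have "(\<phi> has_vector_derivative Re (of_real (r ^ Suc j * X) * cnj \<gamma> * \<gamma>)) (at r)"
        unfolding \<phi>_def by (rule bounded_linear.has_vector_derivative[OF bounded_linear_Re])
      moreover have "of_real (r ^ Suc j * X) * cnj \<gamma> * \<gamma> = of_real (r ^ Suc j * X * (cmod \<gamma>)\<^sup>2)"
        using complex_norm_square[of \<gamma>] by (simp add: mult_ac)
      ultimately have "DERIV \<phi> r :> r ^ Suc j * X * (cmod \<gamma>)\<^sup>2"
        by (simp only: Re_complex_of_real has_real_derivative_iff_has_vector_derivative)
      moreover have "0 < 1 - r\<^sup>2" using r by (simp add: abs_square_less_1)
      then have "0 < r ^ Suc j * X * (cmod \<gamma>)\<^sup>2"
        using r \<gamma> by (simp add: X_def)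
      ultimately show ?thesis by blast
    qed
    have mono: "\<phi> a < \<phi> b" if "0 < a" "a < b" "b < 1" for a b
      by (rule DERIV_pos_imp_increasing) (use that Dpos in auto)
    \<comment> \<open>A single factor \<open>r\<close> is kept from the power; it suffices for the
      limit at 0.\<close>
    have \<phi>_le: "\<bar>\<phi> r\<bar> \<le> r * cmod (C r) * cmod \<gamma>" if r: "0 < r" "r < 1" for r
    proof -
      have "\<bar>\<phi> r\<bar> \<le> cmod (r ^ Suc j *\<^sub>R C r * \<gamma>)"
        unfolding \<phi>_def by (rule abs_Re_le_cmod)
      also have "\<dots> = r ^ Suc j * cmod (C r) * cmod \<gamma>"
        using r by (simp add: norm_mult norm_power)
      also have "\<dots> \<le> r * cmod (C r) * cmod \<gamma>"
        using r by (intro mult_right_mono) (auto intro: mult_left_le power_le_one)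
      finally show ?thesis .
    qed
    \<comment> \<open>The index 1 alone already uses (2 pi r)^2 of the total (2 pi)^2, by
      \<open>c1\<close> and \<open>ge\<close>.\<close>
    have Bessel: "(cmod (C r))\<^sup>2 \<le> (2 * pi)\<^sup>2 * (1 - r\<^sup>2)" if r: "0 < r" "r < 1" for r
    proof -
      have "(cmod (circle_coeff u 1 r))\<^sup>2 + (cmod (C r))\<^sup>2 \<le> (2 * pi)\<^sup>2"
        unfolding C_def by (rule circle_coeff_Bessel[OF kernel_continuous_on(1) r]) (use r bound in auto)
      moreover have "2 * pi * r \<le> cmod (circle_coeff u 1 r)"
        using r mult_left_mono[OF ge, of "2 * pi * r"] by (simp add: c1 norm_mult mult_ac)
      then have "(2 * pi * r)\<^sup>2 \<le> (cmod (circle_coeff u 1 r))\<^sup>2"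
        using r by (intro power_mono) auto
      ultimately have "(2 * pi * r)\<^sup>2 + (cmod (C r))\<^sup>2 \<le> (2 * pi)\<^sup>2"
        by linarith
      then show ?thesis by (simp add: power_mult_distrib algebra_simps)
    qed
    have lim0: "(\<phi> \<longlongrightarrow> 0) (at_right 0)"
    proof (rule Lim_null_comparison)
      have "norm (\<phi> r) \<le> r * (2 * pi) * cmod \<gamma>" if r: "r \<in> {0<..<1}" for r
      proof -
        have "cmod (C r) \<le> 2 * pi"
          using norm_circle_coeff_le[OF kernel_continuous_on(1), of r 1] r bound by (simp add: C_def)
        then have "r * cmod (C r) * cmod \<gamma> \<le> r * (2 * pi) * cmod \<gamma>"
          using r by (intro mult_right_mono mult_left_mono) auto
        with \<phi>_le[of r] r show ?thesis
          unfolding real_norm_def greaterThanLessThan_iff by (blast intro: order_trans)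
      qed
      then show "\<forall>\<^sub>F r in at_right 0. norm (\<phi> r) \<le> r * (2 * pi) * cmod \<gamma>"
        using eventually_at_right_real[of 0 1] by (auto elim!: eventually_mono)
      show "((\<lambda>r. r * (2 * pi) * cmod \<gamma>) \<longlongrightarrow> 0) (at_right 0)"
        by (auto intro!: tendsto_eq_intros)
    qed
    have lim1: "(\<phi> \<longlongrightarrow> 0) (at_left 1)"
    proof (rule Lim_null_comparison)
      have "norm (\<phi> r) \<le> r * sqrt ((2 * pi)\<^sup>2 * (1 - r\<^sup>2)) * cmod \<gamma>" if r: "r \<in> {0<..<1}" for r
      proof -
        have "cmod (C r) \<le> sqrt ((2 * pi)\<^sup>2 * (1 - r\<^sup>2))"
          using Bessel[of r] r by (intro real_le_rsqrt) auto
        then have "r * cmod (C r) * cmod \<gamma> \<le> r * sqrt ((2 * pi)\<^sup>2 * (1 - r\<^sup>2)) * cmod \<gamma>"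
          using r by (intro mult_right_mono mult_left_mono) auto
        with \<phi>_le[of r] r show ?thesis
          unfolding real_norm_def greaterThanLessThan_iff by (blast intro: order_trans)
      qed
      then show "\<forall>\<^sub>F r in at_left 1. norm (\<phi> r) \<le> r * sqrt ((2 * pi)\<^sup>2 * (1 - r\<^sup>2)) * cmod \<gamma>"
        using eventually_at_left_real[of 0 "1::real"] by (auto elim!: eventually_mono)
      have "((\<lambda>r. r * sqrt ((2 * pi)\<^sup>2 * (1 - r\<^sup>2)) * cmod \<gamma>) \<longlongrightarrow>
          1 * sqrt ((2 * pi)\<^sup>2 * (1 - 1\<^sup>2)) * cmod \<gamma>) (at_left 1)"
        by (intro tendsto_intros)
      then show "((\<lambda>r. r * sqrt ((2 * pi)\<^sup>2 * (1 - r\<^sup>2)) * cmod \<gamma>) \<longlongrightarrow> 0) (at_left 1)"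
        by simp
    qed
    \<comment> \<open>A strictly increasing function cannot tend to 0 at both ends of the interval;
      1/4 and 3/4 are arbitrary interior points that exhibit the contradiction.\<close>
    have "0 \<le> \<phi> (1/4)"
    proof (rule tendsto_upperbound[OF lim0])
      show "\<forall>\<^sub>F r in at_right 0. \<phi> r \<le> \<phi> (1/4)"
        using eventually_at_right_real[of 0 "1/4"] mono[of _ "1/4"]
        by (auto elim!: eventually_mono intro: less_imp_le)
    qed simp
    moreover have "\<phi> (3/4) \<le> 0"
    proof (rule tendsto_lowerbound[OF lim1])
      show "\<forall>\<^sub>F r in at_left 1. \<phi> (3/4) \<le> \<phi> r"
        using eventually_at_left_real[of "3/4" 1] mono[of "3/4"]
        by (auto elim!: eventually_mono intro: less_imp_le)
    qed simp
    ultimately show False using mono[of "1/4" "3/4"] by simp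
  qed
  then have "g z = 0" if "z \<in> unit_disk" for z
    using holomorphic_fun_eq_0_on_ball[OF g that] by blast
  then show ?thesis
    by (intro holomorphic_on_Wirtinger kernel_differentiable) (simp_all add: gz)
qed

text \<open>Where \<open>d_z u\<close> is nonzero this is the bound on the dilatation. At a zero of
  \<open>d_z u\<close> the inequality is inherited by continuity from nearby points where the
  dilatation is a genuine quotient.\<close>

lemma kernel_sense_preserving_le:
  assumes "sense_preserving_at u z" and z: "z \<in> unit_disk"
  shows "cmod (d_zbar u z) \<le> cmod (d_z u z)"
proof -
  have dil: "dilatation u w = cnj (d_zbar u w) / d_z u w" if "w \<in> unit_disk" for w
    unfolding dilatation_def by (simp add: d_z_cnj[OF kernel_differentiable(1)[OF that]])
  have le: "cmod (d_zbar u w) \<le> cmod (d_z u w)"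
    if "w \<in> unit_disk" "d_z u w \<noteq> 0" "cmod (dilatation u w) < 1" for w
    using that by (simp add: dil norm_divide)
  obtain \<omega> where \<omega>: "dilatation_value u z \<omega>" "cmod \<omega> < 1"
    using assms unfolding sense_preserving_at_def by blast
  show ?thesis
  proof (cases "d_z u z = 0")
    case False
    then show ?thesis using \<omega> le[OF z] by (auto simp: dilatation_value_def)
  next
    case True
    define S where "S = {z \<in> unit_disk. d_z u z \<noteq> 0}"
    have lp: "z islimpt S" and lim: "(dilatation u \<longlongrightarrow> \<omega>) (at z within S)"
      using \<omega> True by (auto simp: dilatation_value_def S_def)
    have "isCont (d_z u) z" "isCont (d_zbar u) z"
      using kernel_differentiable(2,3)[OF z] by (simp_all add: differentiable_imp_continuous_within)
    then have "((\<lambda>w. cmod (d_zbar u w)) \<longlongrightarrow> cmod (d_zbar u z)) (at z within S)"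
      "((\<lambda>w. cmod (d_z u w)) \<longlongrightarrow> cmod (d_z u z)) (at z within S)"
      unfolding isCont_def by (blast intro: tendsto_norm tendsto_within_subset)+
    moreover have "\<forall>\<^sub>F w in at z within S. cmod (dilatation u w) < 1"
      using order_tendstoD(2)[OF tendsto_norm[OF lim] \<omega>(2)] .
    then have "\<forall>\<^sub>F w in at z within S. cmod (d_zbar u w) \<le> cmod (d_z u w)"
      using eventually_at_topological le unfolding S_def eventually_at_filter
      by (auto elim!: eventually_mono)
    \<comment> \<open>The limit point condition in \<open>dilatation_value\<close> makes the filter
      proper, so that the inequality survives the limit.\<close>
    moreover have "at z within S \<noteq> bot"
      using lp by (simp add: trivial_limit_within)
    ultimately show ?thesis
      using tendsto_le by blast
  qed
qed

end

section \<open>Rigidity through the equality case of the Schwarz lemma\<close>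

theorem theorem1p3:
  fixes \<alpha> :: real and u :: "complex \<Rightarrow> complex"
  assumes "\<alpha> > -1"
    and "kernel_alpha_harmonic \<alpha> u"
    and "sense_preserving u"
    and "u 0 = 0"
    and "\<And>z. z \<in> unit_disk \<Longrightarrow> cmod (u z) < 1"
    and "jacobian_J u 0 = 1 \<or> lambda_min u 0 = 1"
  shows "\<exists>\<beta>::complex. cmod \<beta> = 1 \<and> (\<forall>z\<in>unit_disk. u z = \<beta> * z)"
proof -
  \<comment> \<open>This fixes the sign inside the absolute value of \<open>lambda_min\<close>, so
    that its normalization reads |u_z(0)| = 1 + |u_zbar(0)|.\<close>
  have "cmod (d_zbar u 0) \<le> cmod (d_z u 0)"
    using assms(3) by (intro kernel_sense_preserving_le[OF assms(2)]) (auto simp: sense_preserving_def)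
  moreover have "1 \<le> cmod (d_z u 0)" if "(cmod (d_z u 0))\<^sup>2 = 1 + (cmod (d_zbar u 0))\<^sup>2"
    by (rule power2_le_imp_le) (use that in auto)
  ultimately have ge: "1 \<le> cmod (d_z u 0)"
    using assms(6) norm_ge_zero[of "d_zbar u 0"] unfolding jacobian_J_def lambda_min_def by linarith
  have hol: "u holomorphic_on unit_disk"
    using assms(5) by (intro kernel_bounded_holomorphic[OF assms(2,4) _ ge]) (simp add: less_imp_le)
  then have "(u has_field_derivative deriv u 0) (at 0)"
    by (intro holomorphic_derivI[of _ unit_disk]) auto
  then have "(u has_derivative (\<lambda>v. deriv u 0 * v + 0 * cnj v)) (at 0)"
    by (simp add: has_field_derivative_def)
  then have d: "d_z u 0 = deriv u 0"
    by (rule Wirtinger_eqI(1))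
  \<comment> \<open>Together with \<open>ge\<close> this gives modulus exactly 1, and equality in
    the Schwarz lemma forces a rotation.\<close>
  have "cmod (deriv u 0) \<le> 1"
    by (rule Schwarz_Lemma(2)[OF hol assms(4), of 0]) (use assms(5) in auto)
  with ge d have "cmod (deriv u 0) = 1" by simp
  with Schwarz_Lemma(3)[OF hol assms(4), of 0] assms(5) show ?thesis by auto
qed

end
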